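(* Let $\rho$ and $\rho'$ be two strongly equivalent symmetric measures on $(V\times V,\mathcal B\times\mathcal B)$, disintegrated over the same measure $\mu$ as $\rho=\int_V\rho_x\,d\mu(x)$ and $\rho'=\int_V\rho'_x\,d\mu(x)$, with $d\rho'_x(y)=r_x(y)\,d\rho_x(y)$ for all $x\in V$. Then the corresponding Markov processes $(P,c)$ and $(P',c')$ are strongly equivalent, and for every bounded Borel function $f$ on $V$ and $\mu$-a.e. $x\in V$ $$P'(f)(x)=\frac{P(f r_x)(x)}{P(r_x)(x)}.$$
   Context: $(V,\mathcal B)$ is a standard Borel space, $\mu$ a non-atomic $\sigma$-finite measure on it. A symmetric measure $\rho$ is a $\sigma$-finite measure on $V\times V$ with $\rho(A\times B)=\rho(B\times A)$; its disintegration is a measurable family $x\mapsto\rho_x$ with $\iint f\,d\rho=\int_V\int_V f(x,y)\,d\rho_x(y)\,d\mu(x)$. It is assumed that $c(x)=\rho_x(V)$ and $c'(x)=\rho'_x(V)$ lie in $(0,\infty)$ for $\mu$-a.e. $x$. The Markov operators are $P(f)(x)=\frac1{c(x)}\int_V f(y)\,d\rho_x(y)$ and $P'(f)(x)=\frac1{c'(x)}\int_V f(y)\,d\rho'_x(y)$ (applied also to nonnegative or $\rho_x$-integrable functions). Here $P(fr_x)(x)$ means $\frac1{c(x)}\int_V f(y)r_x(y)\,d\rho_x(y)$. Symmetric measures $\rho,\rho'$ are equivalent if $d\rho'(x,y)=r(x,y)\,d\rho(x,y)$ for some positive measurable function $r$ (then $r_x(y)=r(x,y)$), and strongly equivalent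 if in addition they are disintegrated over the same measure $\mu$ on $V$. The pairs $(P,c)$, $(P',c')$ are called strongly equivalent if the corresponding symmetric measures are strongly equivalent. *)

theory Defs
  imports "HOL-Analysis.Analysis"
begin

text \<open>A measure \<open>\<mu>\<close> carries its measurable space \<open>(V, \<B>)\<close> as \<open>space \<mu>\<close> and
  \<open>sets \<mu>\<close>, so \<open>V\<close> need not be a whole type.\<close>

definition standard_borel :: "'a measure \<Rightarrow> bool" where
  "standard_borel M \<longleftrightarrow>
    (\<exists>T. completely_metrizable_space T \<and> separable_space T \<and> topspace T = space M \<and>
         sets M = sigma_sets (space M) {U. openin T U})"

definition nonatomic :: "'a measure \<Rightarrow> bool" where
  "nonatomic \<mu> \<longleftrightarrow>
    (\<forall>A\<in>sets \<mu>. 0 < emeasure \<mu> A \<longrightarrow>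
      (\<exists>B\<in>sets \<mu>. B \<subseteq> A \<and> 0 < emeasure \<mu> B \<and> emeasure \<mu> B < emeasure \<mu> A))"

text \<open>The argument \<open>M\<close> below is used only for its measurable space.\<close>

definition symmetric_measure :: "'a measure \<Rightarrow> ('a \<times> 'a) measure \<Rightarrow> bool" where
  "symmetric_measure M \<rho> \<longleftrightarrow>
    sets \<rho> = sets (M \<Otimes>\<^sub>M M) \<and> sigma_finite_measure \<rho> \<and>
    (\<forall>A\<in>sets M. \<forall>B\<in>sets M. emeasure \<rho> (A \<times> B) = emeasure \<rho> (B \<times> A))"

text \<open>\<open>\<kappa> x\<close> is the fibre measure \<open>\<rho>\<^sub>x\<close>.\<close>

definition disintegration ::
    "'a measure \<Rightarrow> ('a \<times> 'a) measure \<Rightarrow> ('a \<Rightarrow> 'a measure) \<Rightarrow> bool" where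
  "disintegration \<mu> \<rho> \<kappa> \<longleftrightarrow>
    (\<forall>x\<in>space \<mu>. sets (\<kappa> x) = sets \<mu>) \<and>
    (\<forall>B\<in>sets \<mu>. (\<lambda>x. emeasure (\<kappa> x) B) \<in> borel_measurable \<mu>) \<and>
    (\<forall>f \<in> borel_measurable (\<mu> \<Otimes>\<^sub>M \<mu>).
      (\<integral>\<^sup>+z. f z \<partial>\<rho>) = (\<integral>\<^sup>+x. (\<integral>\<^sup>+y. f (x, y) \<partial>(\<kappa> x)) \<partial>\<mu>))"

definition total_mass :: "('a \<Rightarrow> 'a measure) \<Rightarrow> 'a \<Rightarrow> ennreal" where
  "total_mass \<kappa> x = emeasure (\<kappa> x) (space (\<kappa> x))"

definition markov_op :: "('a \<Rightarrow> 'a measure) \<Rightarrow> ('a \<Rightarrow> real) \<Rightarrow> 'a \<Rightarrow> real" where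
  "markov_op \<kappa> f x = 1 / enn2real (total_mass \<kappa> x) * (\<integral>y. f y \<partial>(\<kappa> x))"

definition equivalent_via ::
    "'a measure \<Rightarrow> ('a \<times> 'a \<Rightarrow> real) \<Rightarrow> ('a \<times> 'a) measure \<Rightarrow> ('a \<times> 'a) measure \<Rightarrow> bool" where
  "equivalent_via M r \<rho> \<rho>' \<longleftrightarrow>
    symmetric_measure M \<rho> \<and> symmetric_measure M \<rho>' \<and>
    r \<in> borel_measurable (M \<Otimes>\<^sub>M M) \<and> (\<forall>z\<in>space (M \<Otimes>\<^sub>M M). 0 < r z) \<and>
    \<rho>' = density \<rho> (\<lambda>z. ennreal (r z))"

definition strongly_equivalent_via ::
    "'a measure \<Rightarrow> ('a \<times> 'a \<Rightarrow> real) \<Rightarrow> ('a \<times> 'a) measure \<Rightarrow> ('a \<times> 'a) measure \<Rightarrow> bool" where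
  "strongly_equivalent_via \<mu> r \<rho> \<rho>' \<longleftrightarrow>
    equivalent_via \<mu> r \<rho> \<rho>' \<and>
    (\<exists>\<kappa>. disintegration \<mu> \<rho> \<kappa>) \<and> (\<exists>\<kappa>'. disintegration \<mu> \<rho>' \<kappa>')"

definition strongly_equivalent ::
    "'a measure \<Rightarrow> ('a \<times> 'a) measure \<Rightarrow> ('a \<times> 'a) measure \<Rightarrow> bool" where
  "strongly_equivalent \<mu> \<rho> \<rho>' \<longleftrightarrow> (\<exists>r. strongly_equivalent_via \<mu> r \<rho> \<rho>')"

text \<open>A pair \<open>(P, c)\<close> corresponds to \<open>\<rho>\<close> if it is obtained from a disintegration of \<open>\<rho>\<close>
  over \<open>\<mu>\<close>. Disintegrations are unique only up to \<open>\<mu>\<close>-null sets, whence the a.e. condition,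
  and \<open>P f x\<close> is meaningful only for \<open>\<rho>\<^sub>x\<close>-integrable \<open>f\<close>.\<close>

definition corresponds_to ::
    "'a measure \<Rightarrow> (('a \<Rightarrow> real) \<Rightarrow> 'a \<Rightarrow> real) \<times> ('a \<Rightarrow> ennreal) \<Rightarrow> ('a \<times> 'a) measure \<Rightarrow> bool"
  where
  "corresponds_to \<mu> Pc \<rho> \<longleftrightarrow>
    (\<exists>\<kappa>. disintegration \<mu> \<rho> \<kappa> \<and>
      (AE x in \<mu>. 0 < total_mass \<kappa> x \<and> total_mass \<kappa> x < \<infinity> \<and> snd Pc x = total_mass \<kappa> x \<and>
        (\<forall>f. integrable (\<kappa> x) f \<longrightarrow> fst Pc f x = markov_op \<kappa> f x)))"

definition strongly_equivalent_pairs ::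
    "'a measure \<Rightarrow> (('a \<Rightarrow> real) \<Rightarrow> 'a \<Rightarrow> real) \<times> ('a \<Rightarrow> ennreal)
      \<Rightarrow> (('a \<Rightarrow> real) \<Rightarrow> 'a \<Rightarrow> real) \<times> ('a \<Rightarrow> ennreal) \<Rightarrow> bool" where
  "strongly_equivalent_pairs \<mu> Pc Pc' \<longleftrightarrow>
    (\<exists>\<rho> \<rho>'. symmetric_measure \<mu> \<rho> \<and> symmetric_measure \<mu> \<rho>' \<and>
      corresponds_to \<mu> Pc \<rho> \<and> corresponds_to \<mu> Pc' \<rho>' \<and> strongly_equivalent \<mu> \<rho> \<rho>')"

end

theory Submission
  imports Defs
begin

text \<open>Since \<open>\<rho>'\<^sub>x\<close> has density \<open>r\<^sub>x\<close> with respect to \<open>\<rho>\<^sub>x\<close>, one has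
  \<open>\<integral>f d\<rho>'\<^sub>x = \<integral>f r\<^sub>x d\<rho>\<^sub>x\<close> and, with \<open>f = 1\<close>, \<open>c'(x) = \<integral>r\<^sub>x d\<rho>\<^sub>x\<close>;
  in the quotient \<open>P(f r\<^sub>x)(x) / P(r\<^sub>x)(x)\<close> the factors \<open>1 / c(x)\<close> cancel.\<close>

lemma disintegration_sets:
  "disintegration \<mu> \<rho> \<kappa> \<Longrightarrow> x \<in> space \<mu> \<Longrightarrow> sets (\<kappa> x) = sets \<mu>"
  by (simp add: disintegration_def)

text \<open>The existential in \<open>corresponds_to\<close> is witnessed by \<open>\<kappa>\<close>
  itself, so the clauses on the operator and on the mass become reflexive and only the bounds on the
  total mass remain.\<close>

lemma corresponds_to_markov_op:
  assumes "disintegration \<mu> \<rho> \<kappa>"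
    and "AE x in \<mu>. 0 < total_mass \<kappa> x \<and> total_mass \<kappa> x < \<infinity>"
  shows "corresponds_to \<mu> (markov_op \<kappa>, total_mass \<kappa>) \<rho>"
  unfolding corresponds_to_def using assms by (intro exI[of _ \<kappa>]) simp

text \<open>This is the quotient formula at one fixed \<open>x\<close>, with \<open>g\<close> in the
  role of the section of r at \<open>x\<close>. It is free of null sets, so the a.e. argument enters
  only when it is applied.\<close>

lemma markov_op_density:
  fixes g :: "'a \<Rightarrow> real"
  assumes \<kappa>': "\<kappa>' x = density (\<kappa> x) (\<lambda>y. ennreal (g y))"
    and f: "f \<in> borel_measurable (\<kappa> x)"
    and g: "g \<in> borel_measurable (\<kappa> x)" "\<And>y. y \<in> space (\<kappa> x) \<Longrightarrow> 0 \<le> g y"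
    and mass: "0 < total_mass \<kappa> x" "total_mass \<kappa> x < \<infinity>"
  shows "markov_op \<kappa>' f x = markov_op \<kappa> (\<lambda>y. f y * g y) x / markov_op \<kappa> g x"
proof -
  have AE_g: "AE y in \<kappa> x. 0 \<le> g y"
    using g(2) by (rule AE_I2)
  have "total_mass \<kappa>' x = (\<integral>\<^sup>+y. ennreal (g y) * indicator (space (\<kappa> x)) y \<partial>\<kappa> x)"
    using g(1) by (simp add: total_mass_def \<kappa>' emeasure_density)
  also have "\<dots> = (\<integral>\<^sup>+y. ennreal (g y) \<partial>\<kappa> x)"
    by (intro nn_integral_cong) simp
  \<comment> \<open>This also covers infinite mass: \<open>enn2real\<close> sends it to 0, and the
    Bochner integral of the then non-integrable \<open>g\<close> is 0 as well.\<close>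
  finally have mass_eq: "enn2real (total_mass \<kappa>' x) = (\<integral>y. g y \<partial>\<kappa> x)"
    using integral_eq_nn_integral[OF g(1) AE_g] by simp
  have "(\<integral>y. f y \<partial>\<kappa>' x) = (\<integral>y. f y * g y \<partial>\<kappa> x)"
    unfolding \<kappa>' using integral_density[OF f g(1) AE_g] by (simp add: mult.commute)
  \<comment> \<open>\<open>enn2real\<close> vanishes at 0 and at infinity, so both bounds in
    \<open>mass\<close> are used to make the factor 1 / c(x) cancellable.\<close>
  moreover have "enn2real (total_mass \<kappa> x) \<noteq> 0"
    using mass by (simp add: enn2real_eq_0_iff less_top)
  ultimately show ?thesis
    by (simp add: markov_op_def mass_eq)
qed

theorem theorem4p7:
  fixes \<mu> :: "'a measure"
    and \<rho> \<rho>' :: "('a \<times> 'a) measure"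
    and \<kappa> \<kappa>' :: "'a \<Rightarrow> 'a measure"
    and r :: "'a \<times> 'a \<Rightarrow> real"
  assumes "standard_borel \<mu>" and "sigma_finite_measure \<mu>" and "nonatomic \<mu>"
    and "strongly_equivalent_via \<mu> r \<rho> \<rho>'"
    and "disintegration \<mu> \<rho> \<kappa>" and "disintegration \<mu> \<rho>' \<kappa>'"
    and "AE x in \<mu>. 0 < total_mass \<kappa> x \<and> total_mass \<kappa> x < \<infinity>"
    and "AE x in \<mu>. 0 < total_mass \<kappa>' x \<and> total_mass \<kappa>' x < \<infinity>"
    and "\<forall>x\<in>space \<mu>. \<kappa>' x = density (\<kappa> x) (\<lambda>y. ennreal (r (x, y)))"
  shows "strongly_equivalent_pairs \<mu>
           (markov_op \<kappa>, total_mass \<kappa>) (markov_op \<kappa>', total_mass \<kappa>') \<and>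
         (\<forall>f :: 'a \<Rightarrow> real. f \<in> borel_measurable \<mu> \<and> bounded (f ` space \<mu>) \<longrightarrow>
           (AE x in \<mu>. markov_op \<kappa>' f x =
              markov_op \<kappa> (\<lambda>y. f y * r (x, y)) x / markov_op \<kappa> (\<lambda>y. r (x, y)) x))"
proof (intro conjI allI impI)
  have "strongly_equivalent \<mu> \<rho> \<rho>'"
    using assms(4) by (auto simp: strongly_equivalent_def)
  moreover have "symmetric_measure \<mu> \<rho>" "symmetric_measure \<mu> \<rho>'"
    using assms(4) by (auto simp: strongly_equivalent_via_def equivalent_via_def)
  ultimately show "strongly_equivalent_pairs \<mu>
      (markov_op \<kappa>, total_mass \<kappa>) (markov_op \<kappa>', total_mass \<kappa>')"
    unfolding strongly_equivalent_pairs_def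
    using corresponds_to_markov_op[OF assms(5,7)] corresponds_to_markov_op[OF assms(6,8)] by blast
next
  fix f :: "'a \<Rightarrow> real"
  assume f: "f \<in> borel_measurable \<mu> \<and> bounded (f ` space \<mu>)"
  have r: "r \<in> borel_measurable (\<mu> \<Otimes>\<^sub>M \<mu>)" "\<And>z. z \<in> space (\<mu> \<Otimes>\<^sub>M \<mu>) \<Longrightarrow> 0 < r z"
    using assms(4) by (auto simp: strongly_equivalent_via_def equivalent_via_def)
  show "AE x in \<mu>. markov_op \<kappa>' f x =
      markov_op \<kappa> (\<lambda>y. f y * r (x, y)) x / markov_op \<kappa> (\<lambda>y. r (x, y)) x"
    \<comment> \<open>\<open>AE_space\<close> restricts to points of \<open>space \<mu>\<close>,
      where the fibres have the sets of \<open>\<mu>\<close> and the density relation between them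
      is available.\<close>
    using assms(7) AE_space
  proof eventually_elim
    case (elim x)
    have sets: "sets (\<kappa> x) = sets \<mu>"
      using disintegration_sets[OF assms(5) elim(2)] .
    show ?case
    proof (rule markov_op_density)
      show "\<kappa>' x = density (\<kappa> x) (\<lambda>y. ennreal (r (x, y)))"
        using assms(9) elim(2) by blast
      show "f \<in> borel_measurable (\<kappa> x)"
        using f by (simp cong: measurable_cong_sets add: sets)
      \<comment> \<open>The section is r composed with the measurable embedding of y as (x, y); it
        is then carried over to the fibre, whose sigma-algebra is the same.\<close>
      have "(\<lambda>y. r (x, y)) \<in> borel_measurable \<mu>"
        using measurable_compose[OF measurable_Pair1'[OF elim(2)] r(1)] .
      then show "(\<lambda>y. r (x, y)) \<in> borel_measurable (\<kappa> x)"
        by (simp cong: measurable_cong_sets add: sets)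
      show "0 \<le> r (x, y)" if "y \<in> space (\<kappa> x)" for y
        using r(2)[of "(x, y)"] that elim(2) sets_eq_imp_space_eq[OF sets]
        by (simp add: space_pair_measure)
    qed (use elim(1) in auto)
  qed
qed

end
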